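(* Let $$g(x)=\frac{2-\dfrac{\sin x}{\sin\frac{x}{2}}}{x^2},\qquad x\in\left(0,\tfrac{\pi}{2}\right).$$ Then for all $x\in(0,\pi/2)$, $$\frac14-\frac{16}{\pi^4}\left(\cosh\frac{\pi}{4}+\frac{\sqrt2}{2}-2\right)x^2\le g(x)\le\frac{4}{\pi^2}\left(\cosh\frac{\pi}{4}-\frac{\sqrt2}{2}\right)-\frac{1}{192}x^2 .$$ Moreover, with $$\delta_1=\frac{\sqrt2\,\pi\, e^{\pi/8}\sqrt{\pi^2+16\sqrt2-32}}{8\sqrt{(\sqrt2-4)e^{\pi/4}+e^{\pi/2}+1}},\qquad \delta_2=\frac{4\sqrt3\,e^{-\pi/8}}{\pi}\sqrt{8+8e^{\pi/2}-(\pi^2+8\sqrt2)e^{\pi/4}},$$ these bounds improve the bounds $\frac{4}{\pi^2}(2-\sqrt2)<g(x)<\frac14$ in the following sense: $$\frac{4}{\pi^2}(2-\sqrt2)\le\frac14-\frac{16}{\pi^4}\left(\cosh\frac{\pi}{4}+\frac{\sqrt2}{2}-2\right)x^2\quad\text{for all }x\in[0,\delta_1],$$ and $$\frac{4}{\pi^2}\left(\cosh\frac{\pi}{4}-\frac{\sqrt2}{2}\right)-\frac{1}{192}x^2\le\frac14\quad\text{for all }x\in[\delta_2,\pi/2].$$ *)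

theory Defs
  imports "HOL-Analysis.Analysis"
begin

(* Only the values on the open interval from 0 to pi / 2 are meaningful. *)
definition g :: "real \<Rightarrow> real" where
  "g x = (2 - sin x / sin (x / 2)) / x\<^sup>2"

definition delta1 :: real where
  "delta1 = (sqrt 2 * pi * exp (pi / 8) * sqrt (pi\<^sup>2 + 16 * sqrt 2 - 32))
     / (8 * sqrt ((sqrt 2 - 4) * exp (pi / 4) + exp (pi / 2) + 1))"

definition delta2 :: real where
  "delta2 = (4 * sqrt 3 * exp (- pi / 8)) / pi
     * sqrt (8 + 8 * exp (pi / 2) - (pi\<^sup>2 + 8 * sqrt 2) * exp (pi / 4))"

end

(* Put t = x / 2, so that g x = (1 - cos t) / (2 t^2)
   = (cosh t - cos t) / (4 t^2) - (cosh t + cos t - 2) / (4 t^2).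
   The power series of cosh t - cos t and of cosh t + cos t - 2 have nonnegative coefficients
   and begin with t^2 and t^4 / 12, so (cosh t - cos t) / t^2 and (cosh t + cos t - 2) / t^4
   are increasing with limits 1 and 1 / 12 at 0. Bounding one summand by its limit at 0 and the
   other by its value at t = pi / 4 gives the two sides of the estimate. *)

theory Submission
  imports Defs
begin

section \<open>Power series with nonnegative coefficients\<close>

lemma nonneg_power_series_lower_bound:
  fixes a :: "nat \<Rightarrow> real"
  assumes sums: "(\<lambda>n. a n * t ^ n) sums A" and nonneg: "\<And>n. a n \<ge> 0" and "t \<ge> 0"
  shows "a k * t ^ k \<le> A"
proof -
  have "(\<Sum>n\<in>{k}. a n * t ^ n) \<le> (\<Sum>n. a n * t ^ n)"
    using assms by (intro sum_le_suminf) (auto simp: sums_iff)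
  then show ?thesis
    using sums by (simp add: sums_iff)
qed

text \<open>Dividing by \<open>t ^ k\<close> cancels against every nonzero term and leaves
  \<open>a n * t ^ (n - k)\<close>, which is nondecreasing in \<open>t\<close>; the sums are then
  compared term by term.\<close>

lemma nonneg_power_series_quotient_mono:
  fixes a :: "nat \<Rightarrow> real"
  assumes s: "(\<lambda>n. a n * s ^ n) sums A" and t: "(\<lambda>n. a n * t ^ n) sums B"
    and nonneg: "\<And>n. a n \<ge> 0" and zero: "\<And>n. n < k \<Longrightarrow> a n = 0"
    and st: "0 < s" "s \<le> t"
  shows "A / s ^ k \<le> B / t ^ k"
proof -
  have "a n * s ^ n / s ^ k \<le> a n * t ^ n / t ^ k" for n
  proof (cases "n < k")
    case False
    then have "s ^ n = s ^ (n - k) * s ^ k" "t ^ n = t ^ (n - k) * t ^ k"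
      by (simp_all flip: power_add)
    then show ?thesis
      using st nonneg[of n] by (simp add: mult_left_mono power_mono)
  qed (simp add: zero)
  then show ?thesis
    by (rule sums_le[OF _ sums_divide[OF s] sums_divide[OF t]])
qed

section \<open>The series of \<open>cosh t - cos t\<close> and
  \<open>cosh t + cos t - 2\<close>\<close>

definition cosh_minus_cos_coeff :: "nat \<Rightarrow> real" where
  "cosh_minus_cos_coeff n = (if even n then 1 / fact n else 0) - cos_coeff n"

definition cosh_plus_cos_minus_2_coeff :: "nat \<Rightarrow> real" where
  "cosh_plus_cos_minus_2_coeff n =
     (if even n then 1 / fact n else 0) + cos_coeff n - (if n = 0 then 2 else 0)"

lemma cosh_sums: "(\<lambda>n. (if even n then 1 / fact n else 0) * t ^ n) sums cosh t" for t :: real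
  using cosh_converges[of t] by (rule back_subst[of "\<lambda>f. f sums cosh t"]) (auto simp: divide_inverse)

lemma cosh_minus_cos_sums: "(\<lambda>n. cosh_minus_cos_coeff n * t ^ n) sums (cosh t - cos t)"
  using sums_diff[OF cosh_sums cos_converges[of t]]
  by (simp add: cosh_minus_cos_coeff_def algebra_simps)

lemma cosh_plus_cos_minus_2_sums:
  "(\<lambda>n. cosh_plus_cos_minus_2_coeff n * t ^ n) sums (cosh t + cos t - 2)"
proof -
  have "(\<lambda>n. if n = 0 then 2 * t ^ n else 0) sums (2 :: real)"
    using sums_single[of 0 "\<lambda>n. 2 * t ^ n"] by simp
  then have "(\<lambda>n. (if n = 0 then 2 else 0) * t ^ n) sums (2 :: real)"
    by (rule back_subst[of "\<lambda>f. f sums 2"]) auto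
  from sums_diff[OF sums_add[OF cosh_sums cos_converges[of t]] this] show ?thesis
    by (simp add: cosh_plus_cos_minus_2_coeff_def algebra_simps)
qed

text \<open>The even coefficients of cos alternate in sign, so they cancel or double those of cosh:
  what remains is 2/n! for n = 2 mod 4, and 0 otherwise.\<close>

lemma cosh_minus_cos_coeff_nonneg: "cosh_minus_cos_coeff n \<ge> 0"
  by (auto simp: cosh_minus_cos_coeff_def cos_coeff_def divide_right_mono minus_one_power_iff)

text \<open>Here 2/n! remains for positive n divisible by 4; subtracting 2 removes the constant
  term.\<close>

lemma cosh_plus_cos_minus_2_coeff_nonneg: "cosh_plus_cos_minus_2_coeff n \<ge> 0"
  by (auto simp: cosh_plus_cos_minus_2_coeff_def cos_coeff_def minus_one_power_iff)

lemma cosh_minus_cos_coeff_eq_0: "n < 2 \<Longrightarrow> cosh_minus_cos_coeff n = 0"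
  by (auto simp: cosh_minus_cos_coeff_def cos_coeff_def less_2_cases_iff)

lemma cosh_plus_cos_minus_2_coeff_eq_0:
  assumes "n < 4"
  shows "cosh_plus_cos_minus_2_coeff n = 0"
proof -
  from assms consider "n = 0" | "n = 1" | "n = 2" | "n = 3"
    by linarith
  then show ?thesis
    by cases (simp_all add: cosh_plus_cos_minus_2_coeff_def cos_coeff_def)
qed

text \<open>The leading term, with coefficient 2/2! = 1, bounds the series from below; this replaces
  a limit at 0.\<close>

lemma cosh_minus_cos_ge: "t \<ge> 0 \<Longrightarrow> t\<^sup>2 \<le> cosh t - cos t" for t :: real
  using nonneg_power_series_lower_bound
    [OF cosh_minus_cos_sums cosh_minus_cos_coeff_nonneg, of t 2]
  by (simp add: cosh_minus_cos_coeff_def cos_coeff_def)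

text \<open>The leading coefficient is 2/4! = 1/12, the source of 1/192 in the theorem.\<close>

lemma cosh_plus_cos_minus_2_ge: "t \<ge> 0 \<Longrightarrow> t ^ 4 / 12 \<le> cosh t + cos t - 2" for t :: real
  using nonneg_power_series_lower_bound
    [OF cosh_plus_cos_minus_2_sums cosh_plus_cos_minus_2_coeff_nonneg, of t 4]
  by (simp add: cosh_plus_cos_minus_2_coeff_def cos_coeff_def fact_numeral)

lemma cosh_minus_cos_quotient_mono:
  "0 < s \<Longrightarrow> s \<le> t \<Longrightarrow> (cosh s - cos s) / s\<^sup>2 \<le> (cosh t - cos t) / t\<^sup>2" for s t :: real
  by (rule nonneg_power_series_quotient_mono[OF cosh_minus_cos_sums cosh_minus_cos_sums])
    (simp_all add: cosh_minus_cos_coeff_nonneg cosh_minus_cos_coeff_eq_0)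

lemma cosh_plus_cos_minus_2_quotient_mono:
  "0 < s \<Longrightarrow> s \<le> t \<Longrightarrow> (cosh s + cos s - 2) / s ^ 4 \<le> (cosh t + cos t - 2) / t ^ 4"
  for s t :: real
  by (rule nonneg_power_series_quotient_mono
      [OF cosh_plus_cos_minus_2_sums cosh_plus_cos_minus_2_sums])
    (simp_all add: cosh_plus_cos_minus_2_coeff_nonneg cosh_plus_cos_minus_2_coeff_eq_0)

section \<open>Strict decrease of (1 - cos t) / t^2\<close>

lemma mult_cos_less_sin:
  fixes x :: real
  assumes "0 < x" "x < pi"
  shows "x * cos x < sin x"
proof -
  have "sin 0 - 0 * cos 0 < sin x - x * cos x"
  proof (rule DERIV_pos_imp_increasing_open[OF assms(1)])
    fix y assume y: "0 < y" "y < x"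
    have "((\<lambda>y. sin y - y * cos y) has_real_derivative y * sin y) (at y)"
      by (auto intro!: derivative_eq_intros)
    moreover have "y * sin y > 0"
      using y assms by (intro mult_pos_pos sin_gt_zero) auto
    ultimately show "\<exists>d. ((\<lambda>y. sin y - y * cos y) has_real_derivative d) (at y) \<and> 0 < d"
      by blast
  qed (intro continuous_intros)
  then show ?thesis
    by simp
qed

lemma sin_quotient_strict_antimono:
  fixes s t :: real
  assumes "0 < s" "s < t" "t < pi"
  shows "sin t / t < sin s / s"
proof (rule DERIV_neg_imp_decreasing[OF assms(2)])
  fix x assume x: "s \<le> x" "x \<le> t"
  have "x * cos x - sin x < 0"
    using mult_cos_less_sin[of x] x assms by auto
  moreover have "((\<lambda>x. sin x / x) has_real_derivative (x * cos x - sin x) / x\<^sup>2) (at x)"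
    using x assms by (auto intro!: derivative_eq_intros simp: field_simps power2_eq_square)
  ultimately show "\<exists>y. ((\<lambda>x. sin x / x) has_real_derivative y) (at x) \<and> y < 0"
    using x assms by (intro exI[of _ "(x * cos x - sin x) / x\<^sup>2"]) (simp add: divide_neg_pos)
qed

lemma one_minus_cos_eq: "1 - cos t = 2 * (sin (t / 2))\<^sup>2" for t :: real
  using cos_double_sin[of "t / 2"] by simp

text \<open>The half-angle formula makes the quotient half the square of sin u / u at u = t/2, which
  is positive and strictly decreasing.\<close>

lemma one_minus_cos_quotient_strict_antimono:
  fixes s t :: real
  assumes "0 < s" "s < t" "t < pi"
  shows "(1 - cos t) / t\<^sup>2 < (1 - cos s) / s\<^sup>2"
proof -
  have "sin (t / 2) / (t / 2) < sin (s / 2) / (s / 2)"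
    using assms by (intro sin_quotient_strict_antimono) auto
  moreover have "sin (t / 2) > 0"
    using assms by (intro sin_gt_zero) auto
  ultimately have "(sin (t / 2) / (t / 2))\<^sup>2 < (sin (s / 2) / (s / 2))\<^sup>2"
    using assms by (intro power_strict_mono) auto
  then show ?thesis
    by (simp add: one_minus_cos_eq power_divide mult.commute)
qed

lemma one_minus_cos_quotient_less:
  fixes t :: real
  assumes "0 < t" "t < pi"
  shows "(1 - cos t) / t\<^sup>2 < 1 / 2"
proof -
  \<comment> \<open>The bound |sin u| \<le> |u| yields only a weak inequality. It is applied at t/2,
    and strict decrease from t/2 to t makes it strict.\<close>
  have "(sin (t / 4))\<^sup>2 \<le> (t / 4)\<^sup>2"
    using abs_sin_x_le_abs_x by (simp add: abs_le_square_iff)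
  then have "(1 - cos (t / 2)) / (t / 2)\<^sup>2 \<le> 1 / 2"
    using assms by (simp add: one_minus_cos_eq field_simps)
  then show ?thesis
    using one_minus_cos_quotient_strict_antimono[of "t / 2" t] assms by linarith
qed

section \<open>The function \<open>g\<close> and its bounds\<close>

lemma g_eq:
  assumes "0 < x" "x < pi / 2"
  shows "g x = (1 - cos (x / 2)) / (x / 2)\<^sup>2 / 2"
proof -
  have "sin (x / 2) > 0"
    using assms by (intro sin_gt_zero) auto
  then have "sin x / sin (x / 2) = 2 * cos (x / 2)"
    using sin_double[of "x / 2"] by simp
  then show ?thesis
    using assms by (simp add: g_def field_simps)
qed

theorem mainTheorem2:
  shows "(\<forall>x\<in>{0<..<pi / 2}.
            1 / 4 - 16 / pi ^ 4 * (cosh (pi / 4) + sqrt 2 / 2 - 2) * x\<^sup>2 \<le> g x \<and>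
            g x \<le> 4 / pi\<^sup>2 * (cosh (pi / 4) - sqrt 2 / 2) - 1 / 192 * x\<^sup>2) \<and>
         (\<forall>x\<in>{0<..<pi / 2}. 4 / pi\<^sup>2 * (2 - sqrt 2) < g x \<and> g x < 1 / 4) \<and>
         (\<forall>x\<in>{0..delta1}.
            4 / pi\<^sup>2 * (2 - sqrt 2)
              \<le> 1 / 4 - 16 / pi ^ 4 * (cosh (pi / 4) + sqrt 2 / 2 - 2) * x\<^sup>2) \<and>
         (\<forall>x\<in>{delta2..pi / 2}.
            4 / pi\<^sup>2 * (cosh (pi / 4) - sqrt 2 / 2) - 1 / 192 * x\<^sup>2 \<le> 1 / 4)"
proof -
  \<comment> \<open>\<open>c\<close> is the right end of the range of t = x/2; the constants of the
    theorem become expressions in the values at \<open>c\<close>.\<close>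
  define c :: real where "c = pi / 4"
  have c: "0 < c" and cosc: "cos c = sqrt 2 / 2" and pi: "pi = 4 * c"
    by (simp_all add: c_def cos_45)
  define P where "P = cosh c - cos c"
  define Q where "Q = cosh c + cos c - 2"
  have P: "c\<^sup>2 \<le> P"
    using cosh_minus_cos_ge[of c] c by (simp add: P_def)
  have "0 < c ^ 4 / 12"
    using c by simp
  then have Q: "0 < Q"
    using cosh_plus_cos_minus_2_ge[of c] c unfolding Q_def by linarith
  have K_lower: "16 / pi ^ 4 * (cosh (pi / 4) + sqrt 2 / 2 - 2) = Q / (16 * c ^ 4)"
    by (simp add: Q_def cosc pi field_simps)
  have K_upper: "4 / pi\<^sup>2 * (cosh (pi / 4) - sqrt 2 / 2) = P / (4 * c\<^sup>2)"
    by (simp add: P_def cosc pi field_simps)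
  \<comment> \<open>The older lower bound is the limit of \<open>g\<close> as x tends to
    pi/2.\<close>
  have g_end: "4 / pi\<^sup>2 * (2 - sqrt 2) = (1 - cos c) / c\<^sup>2 / 2"
    by (simp add: cosc pi field_simps)
  have R: "(1 - cos c) / c\<^sup>2 < 1 / 2"
    using c by (intro one_minus_cos_quotient_less) (simp_all add: c_def)

  have part1: "1 / 4 - Q / (16 * c ^ 4) * x\<^sup>2 \<le> g x \<and> g x \<le> P / (4 * c\<^sup>2) - 1 / 192 * x\<^sup>2"
    and part2: "(1 - cos c) / c\<^sup>2 / 2 < g x \<and> g x < 1 / 4"
    if x: "x \<in> {0<..<pi / 2}" for x
  proof -
    define t where "t = x / 2"
    have t: "0 < t" "t < c" "c < pi" and xt: "x = 2 * t"
      using x by (auto simp: t_def c_def)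
    have gx: "g x = (1 - cos t) / t\<^sup>2 / 2"
      using g_eq[of x] x by (simp add: t_def)
    have split: "g x = (cosh t - cos t) / t\<^sup>2 / 4 - (cosh t + cos t - 2) / t ^ 4 * t\<^sup>2 / 4"
      using t(1) by (simp add: gx field_simps power4_eq_xxxx power2_eq_square)
    have "1 \<le> (cosh t - cos t) / t\<^sup>2" "(cosh t - cos t) / t\<^sup>2 \<le> P / c\<^sup>2"
      using cosh_minus_cos_ge[of t] cosh_minus_cos_quotient_mono[of t c] t
      by (simp_all add: P_def)
    moreover have "1 / 12 \<le> (cosh t + cos t - 2) / t ^ 4" "(cosh t + cos t - 2) / t ^ 4 \<le> Q / c ^ 4"
      using cosh_plus_cos_minus_2_ge[of t] cosh_plus_cos_minus_2_quotient_mono[of t c] t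
      by (simp_all add: Q_def field_simps)
    \<comment> \<open>In \<open>split\<close> these bounds are divided by 4; as x = 2t, they
      contribute x^2/192 and Q x^2 / (16 c^4).\<close>
    then have "1 / 12 * t\<^sup>2 \<le> (cosh t + cos t - 2) / t ^ 4 * t\<^sup>2"
      "(cosh t + cos t - 2) / t ^ 4 * t\<^sup>2 \<le> Q / c ^ 4 * t\<^sup>2"
      by (intro mult_right_mono; simp)+
    ultimately show "1 / 4 - Q / (16 * c ^ 4) * x\<^sup>2 \<le> g x \<and> g x \<le> P / (4 * c\<^sup>2) - 1 / 192 * x\<^sup>2"
      unfolding split by (simp add: xt power_mult_distrib)
    show "(1 - cos c) / c\<^sup>2 / 2 < g x \<and> g x < 1 / 4"
      using one_minus_cos_quotient_less[of t] one_minus_cos_quotient_strict_antimono[of t c] t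
      by (simp add: gx)
  qed

  \<comment> \<open>Ranges on which the new bounds improve the old ones\<close>
  have exp_half: "exp (pi / 2) = (exp c)\<^sup>2"
    by (simp add: c_def flip: exp_double)
  \<comment> \<open>Squaring \<open>delta1\<close> and \<open>delta2\<close> turns their factors
    with pi/8 into exp c and its inverse, which cancel against the exp c contained in the
    radicands.\<close>
  have exp_eighth: "(exp (pi / 8))\<^sup>2 = exp c" "(exp (- (pi / 8)))\<^sup>2 = inverse (exp c)"
    by (simp_all add: c_def flip: exp_double exp_minus)
  have cosh: "cosh c = (exp c + inverse (exp c)) / 2"
    by (simp add: cosh_field_def exp_minus)

  have part3: "(1 - cos c) / c\<^sup>2 / 2 \<le> 1 / 4 - Q / (16 * c ^ 4) * x\<^sup>2"
    if x: "x \<in> {0..delta1}" for x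
  proof -
    define D where "D = (sqrt 2 - 4) * exp (pi / 4) + exp (pi / 2) + 1"
    define N where "N = pi\<^sup>2 + 16 * sqrt 2 - 32"
    have D: "D = 2 * exp c * Q"
      unfolding D_def Q_def cosh cosc exp_half
      by (simp add: c_def[symmetric] field_simps power2_eq_square)
    have N: "N = 16 * (c\<^sup>2 - 2 * (1 - cos c))"
      by (simp add: N_def pi cosc field_simps)
    \<comment> \<open>The signs of \<open>N\<close> and \<open>D\<close> ensure that squaring undoes
      the square roots in \<open>delta1\<close>.\<close>
    have "N \<ge> 0"
      using R c by (simp add: N field_simps)
    have "D > 0"
      using Q by (simp add: D)
    have "delta1\<^sup>2 = 2 * pi\<^sup>2 * exp c * N / (64 * D)"
      unfolding delta1_def D_def[symmetric] N_def[symmetric]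
      using \<open>N \<ge> 0\<close> \<open>D > 0\<close> by (simp add: power_divide power_mult_distrib exp_eighth)
    also have "\<dots> = 4 * c\<^sup>2 * (c\<^sup>2 - 2 * (1 - cos c)) / Q"
      using Q by (simp add: D N pi field_simps)
    \<comment> \<open>So \<open>delta1\<close> is the point where the lower bound has fallen to the
      value \<open>g_end\<close>; before it the bound is larger.\<close>
    finally have "Q / (16 * c ^ 4) * delta1\<^sup>2 = 1 / 4 - (1 - cos c) / c\<^sup>2 / 2"
      using c Q by (simp add: field_simps power2_eq_square power4_eq_xxxx)
    moreover have "Q / (16 * c ^ 4) * x\<^sup>2 \<le> Q / (16 * c ^ 4) * delta1\<^sup>2"
      using x Q by (intro mult_left_mono power_mono) auto
    ultimately show ?thesis
      by linarith
  qed

  have part4: "P / (4 * c\<^sup>2) - 1 / 192 * x\<^sup>2 \<le> 1 / 4" if x: "x \<in> {delta2..pi / 2}" for x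
  proof -
    define E where "E = 8 + 8 * exp (pi / 2) - (pi\<^sup>2 + 8 * sqrt 2) * exp (pi / 4)"
    have E: "E = 16 * exp c * (P - c\<^sup>2)"
      unfolding E_def P_def cosh cosc exp_half
      by (simp add: pi field_simps power2_eq_square)
    have "E \<ge> 0"
      using P by (simp add: E)
    \<comment> \<open>Squaring \<open>delta2\<close> \<le> x below needs this sign, since x is
      bounded below by \<open>delta2\<close> alone.\<close>
    then have "delta2 \<ge> 0"
      unfolding delta2_def E_def[symmetric] by simp
    have "delta2\<^sup>2 = 48 * inverse (exp c) / pi\<^sup>2 * E"
      unfolding delta2_def E_def[symmetric]
      using \<open>E \<ge> 0\<close> by (simp add: power_divide power_mult_distrib exp_eighth)
    also have "\<dots> = 48 * (P - c\<^sup>2) / c\<^sup>2"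
      using c by (simp add: E pi field_simps)
    \<comment> \<open>So the upper bound equals 1/4 exactly at \<open>delta2\<close> and decreases
      from there.\<close>
    finally have "1 / 192 * delta2\<^sup>2 = P / (4 * c\<^sup>2) - 1 / 4"
      using c by (simp add: field_simps)
    moreover have "delta2\<^sup>2 \<le> x\<^sup>2"
      using x \<open>delta2 \<ge> 0\<close> by (intro power_mono) auto
    ultimately show ?thesis
      by linarith
  qed

  show ?thesis
    unfolding K_lower K_upper g_end
    using part1 part2 part3 part4 by blast
qed

end
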